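(* Let $\mathcal{N}=\{1,\ldots,N_B\}$ be a finite nonempty set of beams with per-cycle demands $D_b\in\mathbb{R}_{\ge 0}$ ($b\in\mathcal{N}$), not all zero, let $M=\max\{D_b : b\in\mathcal{N}\}$, let $\beta(b)\subset\mathcal{N}\setminus\{b\}$ be the set of beams neighbouring $b$, and let $\mathcal{P}=\{1,\ldots,|\mathcal{P}|\}$ be a finite index set of patterns, where $|\mathcal{P}|$ is an upper bound on the number of patterns required. Consider the mixed integer linear program $$ \begin{aligned} \min\ & \sum_{p\in\mathcal{P}} z^{p}\\ \text{s.t. } & y^{p}_b\le z^{p} && \forall p\in\mathcal{P},\ b\in\mathcal{N},\\ & x^p_b\le D_b\, y^p_b && \forall p\in\mathcal{P},\ b\in\mathcal{N},\\ & \sum_{p\in\mathcal{P}} x^p_b= D_b && \forall b\in\mathcal{N},\\ & x^p_b\le T^p+M(1-y^p_b) && \forall p\in\mathcal{P},\ b\in\mathcal{N},\\ & T^p-M(1-y^p_b)\le x^p_b && \forall p\in\mathcal{P},\ b\in\mathcal{N},\\ & y^p_b+y^p_{b'}\le 1 && \forall p\in\mathcal{P},\ b\in\mathcal{N},\ b'\in\beta(b),\\ & z^p\in\{0,1\},\quad y^p_b\in\{0,1\},\quad T^p\ge 0,\quad x^p_b\ge 0 && \forall p\in\mathcal{P},\ b\in\mathcal{N}. \end{aligned} $$ Then the optimal value $w^*$ of the linear programming relaxation of this program is $1$.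
   Context: The linear programming relaxation is obtained by replacing the conditions $z^{p}\in\{0,1\}$ and $y^{p}_b\in\{0,1\}$ by $0\le z^{p}\le 1$ and $0\le y^{p}_b\le 1$, keeping $T^p, x^p_b$ as nonnegative real variables. Interpretation: $z^p=1$ if pattern $p$ is used; $y^p_b=1$ if beam $b$ is illuminated in pattern $p$; $T^p$ is the dwell time of pattern $p$; $x^p_b$ is the illumination duration of beam $b$ in pattern $p$. The program minimizes the number of beam illumination patterns so that each beam $b$ receives total illumination $D_b$, with no two neighbouring beams illuminated in the same pattern. Standing assumption: "$|\mathcal{P}|$ is an upper bound on the number of patterns required" means that $|\mathcal{P}|$ is at least the minimum number of patterns needed for a mixed integer solution; in particular the displayed mixed integer program with this $\mathcal{P}$ is feasible. *)

theory Defs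
  imports Complex_Main
begin

text \<open>
  Beams are the elements of \<open>{1..N}\<close> and patterns the elements of \<open>{1..K}\<close>. The fields hold the
  decision variables \<open>z\<^sup>p\<close>, \<open>y\<^sup>p\<^sub>b\<close>, \<open>T\<^sup>p\<close>, \<open>x\<^sup>p\<^sub>b\<close>, with the pattern as the first argument; values at
  indices outside these ranges are unconstrained and do not enter the objective.
\<close>

record assignment =
  pat_used :: "nat \<Rightarrow> real"
  beam_on :: "nat \<Rightarrow> nat \<Rightarrow> real"
  dwell :: "nat \<Rightarrow> real"
  duration :: "nat \<Rightarrow> nat \<Rightarrow> real"

definition max_demand :: "nat \<Rightarrow> (nat \<Rightarrow> real) \<Rightarrow> real" where
  "max_demand N D = Max (D ` {1..N})"

definition pattern_constraints ::
    "nat \<Rightarrow> (nat \<Rightarrow> real) \<Rightarrow> (nat \<Rightarrow> nat set) \<Rightarrow> nat \<Rightarrow> assignment \<Rightarrow> bool" where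
  "pattern_constraints N D \<beta> K s \<longleftrightarrow>
    (let z = pat_used s; y = beam_on s; T = dwell s; x = duration s; M = max_demand N D in
      (\<forall>p\<in>{1..K}. \<forall>b\<in>{1..N}. y p b \<le> z p) \<and>
      (\<forall>p\<in>{1..K}. \<forall>b\<in>{1..N}. x p b \<le> D b * y p b) \<and>
      (\<forall>b\<in>{1..N}. (\<Sum>p\<in>{1..K}. x p b) = D b) \<and>
      (\<forall>p\<in>{1..K}. \<forall>b\<in>{1..N}. x p b \<le> T p + M * (1 - y p b)) \<and>
      (\<forall>p\<in>{1..K}. \<forall>b\<in>{1..N}. T p - M * (1 - y p b) \<le> x p b) \<and>
      (\<forall>p\<in>{1..K}. \<forall>b\<in>{1..N}. \<forall>b'\<in>\<beta> b. y p b + y p b' \<le> 1) \<and>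
      (\<forall>p\<in>{1..K}. T p \<ge> 0) \<and>
      (\<forall>p\<in>{1..K}. \<forall>b\<in>{1..N}. x p b \<ge> 0))"

definition milp_feasible ::
    "nat \<Rightarrow> (nat \<Rightarrow> real) \<Rightarrow> (nat \<Rightarrow> nat set) \<Rightarrow> nat \<Rightarrow> assignment \<Rightarrow> bool" where
  "milp_feasible N D \<beta> K s \<longleftrightarrow>
    pattern_constraints N D \<beta> K s \<and>
    (\<forall>p\<in>{1..K}. pat_used s p \<in> {0, 1}) \<and>
    (\<forall>p\<in>{1..K}. \<forall>b\<in>{1..N}. beam_on s p b \<in> {0, 1})"

definition lp_feasible ::
    "nat \<Rightarrow> (nat \<Rightarrow> real) \<Rightarrow> (nat \<Rightarrow> nat set) \<Rightarrow> nat \<Rightarrow> assignment \<Rightarrow> bool" where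
  "lp_feasible N D \<beta> K s \<longleftrightarrow>
    pattern_constraints N D \<beta> K s \<and>
    (\<forall>p\<in>{1..K}. 0 \<le> pat_used s p \<and> pat_used s p \<le> 1) \<and>
    (\<forall>p\<in>{1..K}. \<forall>b\<in>{1..N}. 0 \<le> beam_on s p b \<and> beam_on s p b \<le> 1)"

definition pattern_count :: "nat \<Rightarrow> assignment \<Rightarrow> real" where
  "pattern_count K s = (\<Sum>p\<in>{1..K}. pat_used s p)"

text \<open>
  If the demands are nonnegative and no beam neighbours itself, then \<open>N\<close> patterns suffice
  (illuminate one beam at a time), so the least number below exists.
\<close>

definition patterns_required :: "nat \<Rightarrow> (nat \<Rightarrow> real) \<Rightarrow> (nat \<Rightarrow> nat set) \<Rightarrow> nat" where
  "patterns_required N D \<beta> = (LEAST k. \<exists>s. milp_feasible N D \<beta> k s)"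

text \<open>
  The optimal value is an attained minimum, so having one includes feasibility.
\<close>

definition lp_optimal_value ::
    "nat \<Rightarrow> (nat \<Rightarrow> real) \<Rightarrow> (nat \<Rightarrow> nat set) \<Rightarrow> nat \<Rightarrow> real \<Rightarrow> bool" where
  "lp_optimal_value N D \<beta> K w \<longleftrightarrow>
    (\<exists>s. is_arg_min (pattern_count K) (lp_feasible N D \<beta> K) s \<and> pattern_count K s = w)"

end

theory Submission
  imports Defs
begin

text \<open>
  Summing \<open>x\<^sup>p\<^sub>b \<le> D\<^sub>b y\<^sup>p\<^sub>b \<le> D\<^sub>b z\<^sup>p\<close> over the patterns for one beam with \<open>D\<^sub>b > 0\<close> gives
  \<open>\<Sum>\<^sub>p z\<^sup>p \<ge> 1\<close>. With at least two patterns the bound is attained by sharing everything equally,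
  \<open>z\<^sup>p = y\<^sup>p\<^sub>b = 1/K\<close> and \<open>x\<^sup>p\<^sub>b = D\<^sub>b/K\<close>: since \<open>1/K \<le> 1/2\<close>, both the neighbour constraints
  and the big-\<open>M\<close> constraints (with \<open>T\<^sup>p = 0\<close>) are slack. With a single pattern the integer
  solution itself has value \<open>1\<close>.
\<close>

lemma max_demand_ge: "b \<in> {1..N} \<Longrightarrow> D b \<le> max_demand N D"
  unfolding max_demand_def by (rule Max_ge) auto

lemma milp_feasible_imp_lp_feasible: "milp_feasible N D \<beta> K s \<Longrightarrow> lp_feasible N D \<beta> K s"
  unfolding milp_feasible_def lp_feasible_def by force

lemma pattern_count_ge_1:
  assumes "pattern_constraints N D \<beta> K s" "b \<in> {1..N}" "D b > 0"
  shows "pattern_count K s \<ge> 1"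
proof -
  have y: "beam_on s p b \<le> pat_used s p" and x: "duration s p b \<le> D b * beam_on s p b"
    if "p \<in> {1..K}" for p
    using assms that unfolding pattern_constraints_def Let_def by blast+
  have "D b = (\<Sum>p\<in>{1..K}. duration s p b)"
    using assms(1,2) unfolding pattern_constraints_def Let_def by simp
  also have "\<dots> \<le> (\<Sum>p\<in>{1..K}. D b * pat_used s p)"
  proof (rule sum_mono)
    fix p assume "p \<in> {1..K}"
    then show "duration s p b \<le> D b * pat_used s p"
      using x y assms(3) by (meson less_imp_le mult_left_mono order_trans)
  qed
  also have "\<dots> = D b * pattern_count K s"
    by (simp add: pattern_count_def sum_distrib_left)
  finally show ?thesis
    using assms(3) by simp
qed

text \<open>Pattern \<open>p\<close> serves beam \<open>p\<close> alone for its whole demand. For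
  every other beam the big-M constraints hold because \<open>D p\<close> is at most the maximal
  demand.\<close>

lemma milp_feasible_one_beam_per_pattern:
  assumes "\<And>b. b \<in> {1..N} \<Longrightarrow> D b \<ge> 0"
    and "\<And>b. b \<in> {1..N} \<Longrightarrow> b \<notin> \<beta> b"
  shows "milp_feasible N D \<beta> N
    \<lparr>pat_used = \<lambda>_. 1, beam_on = \<lambda>p b. of_bool (p = b), dwell = D,
     duration = \<lambda>p b. if p = b then D b else 0\<rparr>"
  using assms max_demand_ge[of _ N D]
  unfolding milp_feasible_def pattern_constraints_def Let_def
  by (auto simp: sum.delta order_trans[OF assms(1) max_demand_ge])

lemma milp_feasible_patterns_required:
  assumes "\<And>b. b \<in> {1..N} \<Longrightarrow> D b \<ge> 0"
    and "\<And>b. b \<in> {1..N} \<Longrightarrow> b \<notin> \<beta> b"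
  shows "\<exists>s. milp_feasible N D \<beta> (patterns_required N D \<beta>) s"
  unfolding patterns_required_def
  by (rule LeastI_ex, intro exI, rule milp_feasible_one_beam_per_pattern[OF assms])

lemma lp_feasible_equal_shares:
  assumes "\<And>b. b \<in> {1..N} \<Longrightarrow> D b \<ge> 0" and "K \<ge> 2"
  shows "lp_feasible N D \<beta> K
    \<lparr>pat_used = \<lambda>_. 1 / K, beam_on = \<lambda>_ _. 1 / K, dwell = \<lambda>_. 0,
     duration = \<lambda>_ b. D b / K\<rparr>"
proof -
  have K: "1 / real K \<le> 1 / 2"
    using assms(2) by (simp add: field_simps)
  have "D b / K \<le> max_demand N D * (1 - 1 / K)" "- (max_demand N D * (1 - 1 / K)) \<le> D b / K"
    if b: "b \<in> {1..N}" for b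
  proof -
    have M: "0 \<le> D b" "D b \<le> max_demand N D"
      using assms(1) max_demand_ge b by blast+
    \<comment> \<open>Factorwise comparison: \<open>1 / K \<le> 1 - 1 / K\<close> because
      \<open>1 / K \<le> 1 / 2\<close>.\<close>
    have "D b * (1 / K) \<le> max_demand N D * (1 - 1 / K)"
      using M K by (intro mult_mono) auto
    then show "D b / K \<le> max_demand N D * (1 - 1 / K)"
      by simp
    moreover have "0 \<le> D b / K"
      using M by simp
    ultimately show "- (max_demand N D * (1 - 1 / K)) \<le> D b / K"
      by linarith
  qed
  then show ?thesis
    using assms K unfolding lp_feasible_def pattern_constraints_def Let_def by auto
qed

theorem proposition2:
  fixes N K :: nat
    and D :: "nat \<Rightarrow> real"
    and \<beta> :: "nat \<Rightarrow> nat set"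
  assumes "N \<ge> 1"
    and "\<And>b. b \<in> {1..N} \<Longrightarrow> D b \<ge> 0"
    and "\<exists>b\<in>{1..N}. D b \<noteq> 0"
    and "\<And>b. b \<in> {1..N} \<Longrightarrow> \<beta> b \<subseteq> {1..N} - {b}"
    and "patterns_required N D \<beta> \<le> K"
  shows "lp_optimal_value N D \<beta> K 1"
proof -
  obtain b where b: "b \<in> {1..N}" "D b > 0"
    using assms(2,3) by force
  \<comment> \<open>The number of patterns is left general: the bound is also applied to the least
    pattern number, before that is known to equal \<open>K\<close>.\<close>
  have lower: "pattern_count k s \<ge> 1" if "lp_feasible N D \<beta> k s" for k s
    using that pattern_count_ge_1 b unfolding lp_feasible_def by blast
  have "\<exists>s. lp_feasible N D \<beta> K s \<and> pattern_count K s = 1"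
  proof (cases "K \<ge> 2")
    case True
    then show ?thesis
      using lp_feasible_equal_shares[of N D K \<beta>] assms(2)
      by (intro exI conjI) (auto simp: pattern_count_def)
  next
    case False
    let ?k = "patterns_required N D \<beta>"
    have "b \<notin> \<beta> b" if "b \<in> {1..N}" for b
      using assms(4) that by blast
    then obtain s where s: "lp_feasible N D \<beta> ?k s"
      using milp_feasible_patterns_required assms(2) milp_feasible_imp_lp_feasible by metis
    \<comment> \<open>With no patterns the objective is an empty sum, contradicting the lower bound;
      \<open>?k \<le> K < 2\<close> then leaves only 1.\<close>
    have "?k \<noteq> 0"
      using lower[OF s] by (intro notI) (simp add: pattern_count_def)
    then have k: "?k = 1" "K = 1"
      using False assms(5) by linarith+
    \<comment> \<open>The objective is a single summand, which the relaxation bounds by 1.\<close>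
    have "pattern_count 1 s \<le> 1"
      using s k unfolding lp_feasible_def pattern_count_def by simp
    then show ?thesis
      using s lower[OF s] k by force
  qed
  then show ?thesis
    using lower unfolding lp_optimal_value_def is_arg_min_def by (metis not_less)
qed

end
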